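(* Let $f:\mathbb{R}^n\to\mathbb{R}$ be convex and locally Lipschitz continuous, let $\lambda>0$, and consider the quantities $\tilde g_k$, $d_k$, $\theta_k$ generated by Algorithm W (described in the context). Then for all $k\ge0$ (for which these quantities are generated), $$\tilde g_k^\top d_k\le-\left(\theta_k-\tfrac14\right)\|\tilde g_k\|^2,\qquad \|d_k\|\le\left(\theta_k+\tfrac14\right)\|\tilde g_k\|.$$
   Context: $\|\cdot\|$ is the Euclidean norm on $\mathbb{R}^n$. Moreau-Yosida regularization: $F(x)=\min_{z\in\mathbb{R}^n}\{f(z)+\frac{1}{2\lambda}\|z-x\|^2\}$. Inexact quantities: for each $x\in\mathbb{R}^n$ and $\varepsilon>0$, $p^a(x,\varepsilon)$ denotes a chosen point satisfying $f(p^a(x,\varepsilon))+\frac1{2\lambda}\|p^a(x,\varepsilon)-x\|^2\le F(x)+\varepsilon$. Set $F^a(x,\varepsilon)=f(p^a(x,\varepsilon))+\frac{1}{2\lambda}\|p^a(x,\varepsilon)-x\|^2$ and $g^a(x,\varepsilon)=(x-p^a(x,\varepsilon))/\lambda$. Algorithm W. Parameters: $x_0\in\mathbb{R}^n$, $\lambda>0$, $0<\delta\le\sigma<1$, $0<\eta<\frac34$, $\tau>\frac14+\eta$, $\varepsilon_0\in(0,1)$, safeguard $\rho_0>0$. Set $\tilde g_0=g^a(x_0,\varepsilon_0)$, $d_0=-\tilde g_0$, $\theta_0=1$. For $k=0,1,2,\dots$: Step 1. If $\tilde g_k=0$, stop. Step 2. Choose $\varepsilon_{k+1}\in(0,\varepsilon_k)$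 and a step length $\alpha_k>0$ such that, with $x_{k+1}=x_k+\alpha_kd_k$ and $\tilde g_{k+1}=g^a(x_{k+1},\varepsilon_{k+1})$, the Wolfe-type conditions hold: $$F^a(x_k+\alpha_kd_k,\varepsilon_{k+1})-F^a(x_k,\varepsilon_k)\le\delta\alpha_k\tilde g_k^\top d_k,\qquad \tilde g_{k+1}^\top d_k\ge\sigma\tilde g_k^\top d_k.$$ Step 3. Set $y_k=\tilde g_{k+1}-\tilde g_k$. Step 4. If $|d_k^\top y_k|<\rho_0$, set $\beta_k=0$, $\theta_{k+1}=1$. Otherwise let $$\hat\beta_k=\frac{\tilde g_{k+1}^\top y_k}{d_k^\top y_k}-\|y_k\|^2\frac{d_k^\top\tilde g_{k+1}}{(d_k^\top y_k)^2},\qquad \theta^{QN}_{k+1}=1-\|y_k\|^2\frac{d_k^\top\tilde g_{k+1}}{(d_k^\top y_k)(y_k^\top\tilde g_{k+1})};$$ set $\beta_k=\hat\beta_k$ if $|\hat\beta_k|\,\|d_k\|\le\frac14\|\tilde g_{k+1}\|$, and $\beta_k=\operatorname{sign}(\hat\beta_k)\frac{\|\tilde g_{k+1}\|}{4\|d_k\|}$ otherwise; set $\theta_{k+1}=\theta^{QN}_{k+1}$ if $\theta^{QN}_{k+1}$ is defined and lies in $[\frac14+\eta,\tau]$, and $\theta_{k+1}=1$ otherwise. Step 5. Set $d_{k+1}=-\theta_{k+1}\tilde g_{k+1}+\beta_kd_k$ and continue with $k+1$. It is assumed that step lengths satisfying Step 2 are found at every iteration performed. *)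

theory Defs
  imports "HOL-Analysis.Analysis"
begin

definition locally_lipschitz :: "(real ^ 'n \<Rightarrow> real) \<Rightarrow> bool" where
  "locally_lipschitz f \<longleftrightarrow> (\<forall>x. \<exists>r>0. \<exists>L. L-lipschitz_on (cball x r) f)"

definition prox_objective ::
  "(real ^ 'n \<Rightarrow> real) \<Rightarrow> real \<Rightarrow> real ^ 'n \<Rightarrow> real ^ 'n \<Rightarrow> real" where
  "prox_objective f lam x z = f z + 1 / (2 * lam) * (norm (z - x))\<^sup>2"

text \<open>The Moreau-Yosida regularization is a genuine minimum: for convex f and positive lam the
  objective is continuous and coercive, so its range has a least element.\<close>

definition moreau_yosida :: "(real ^ 'n \<Rightarrow> real) \<Rightarrow> real \<Rightarrow> real ^ 'n \<Rightarrow> real" where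
  "moreau_yosida f lam x = (LEAST v. v \<in> range (prox_objective f lam x))"

definition inexact_prox ::
  "(real ^ 'n \<Rightarrow> real) \<Rightarrow> real \<Rightarrow> (real ^ 'n \<Rightarrow> real \<Rightarrow> real ^ 'n) \<Rightarrow> bool" where
  "inexact_prox f lam pa \<longleftrightarrow>
     (\<forall>x \<epsilon>. \<epsilon> > 0 \<longrightarrow>
        f (pa x \<epsilon>) + 1 / (2 * lam) * (norm (pa x \<epsilon> - x))\<^sup>2 \<le> moreau_yosida f lam x + \<epsilon>)"

definition inexact_value ::
  "(real ^ 'n \<Rightarrow> real) \<Rightarrow> real \<Rightarrow> (real ^ 'n \<Rightarrow> real \<Rightarrow> real ^ 'n) \<Rightarrow> real ^ 'n \<Rightarrow> real \<Rightarrow> real" where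
  "inexact_value f lam pa x \<epsilon> = f (pa x \<epsilon>) + 1 / (2 * lam) * (norm (pa x \<epsilon> - x))\<^sup>2"

definition inexact_gradient ::
  "real \<Rightarrow> (real ^ 'n \<Rightarrow> real \<Rightarrow> real ^ 'n) \<Rightarrow> real ^ 'n \<Rightarrow> real \<Rightarrow> real ^ 'n" where
  "inexact_gradient lam pa x \<epsilon> = (x - pa x \<epsilon>) /\<^sub>R lam"

text \<open>In the update formulas, g is the new inexact gradient (index k+1), while d and y carry
  the index k.\<close>

definition beta_hat :: "real ^ 'n \<Rightarrow> real ^ 'n \<Rightarrow> real ^ 'n \<Rightarrow> real" where
  "beta_hat g d y = (g \<bullet> y) / (d \<bullet> y) - (norm y)\<^sup>2 * ((d \<bullet> g) / (d \<bullet> y)\<^sup>2)"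

definition theta_QN :: "real ^ 'n \<Rightarrow> real ^ 'n \<Rightarrow> real ^ 'n \<Rightarrow> real" where
  "theta_QN g d y = 1 - (norm y)\<^sup>2 * ((d \<bullet> g) / ((d \<bullet> y) * (y \<bullet> g)))"

text \<open>Since division is total in HOL, definedness of the quotient is recorded separately.\<close>

definition theta_QN_defined :: "real ^ 'n \<Rightarrow> real ^ 'n \<Rightarrow> real ^ 'n \<Rightarrow> bool" where
  "theta_QN_defined g d y \<longleftrightarrow> (d \<bullet> y) * (y \<bullet> g) \<noteq> 0"

definition beta_update :: "real \<Rightarrow> real ^ 'n \<Rightarrow> real ^ 'n \<Rightarrow> real ^ 'n \<Rightarrow> real" where
  "beta_update \<rho>\<^sub>0 g d y =
     (if \<bar>d \<bullet> y\<bar> < \<rho>\<^sub>0 then 0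
      else if \<bar>beta_hat g d y\<bar> * norm d \<le> 1 / 4 * norm g then beta_hat g d y
      else sgn (beta_hat g d y) * (norm g / (4 * norm d)))"

definition theta_update ::
  "real \<Rightarrow> real \<Rightarrow> real \<Rightarrow> real ^ 'n \<Rightarrow> real ^ 'n \<Rightarrow> real ^ 'n \<Rightarrow> real" where
  "theta_update \<eta> \<tau> \<rho>\<^sub>0 g d y =
     (if \<bar>d \<bullet> y\<bar> < \<rho>\<^sub>0 then 1
      else if theta_QN_defined g d y \<and> theta_QN g d y \<in> {1 / 4 + \<eta> .. \<tau>} then theta_QN g d y
      else 1)"

text \<open>A run of the algorithm is given by total sequences. Iteration k is performed iff the stopping
  test has failed at every index up to k; only then are the choices and updates of that iteration
  constrained, so a run may be infinite or may stop. The entries of index k are generated by the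
  run iff the stopping test has failed at every index below k.\<close>

definition performed :: "(nat \<Rightarrow> real ^ 'n) \<Rightarrow> nat \<Rightarrow> bool" where
  "performed g k \<longleftrightarrow> (\<forall>j\<le>k. g j \<noteq> 0)"

definition generated :: "(nat \<Rightarrow> real ^ 'n) \<Rightarrow> nat \<Rightarrow> bool" where
  "generated g k \<longleftrightarrow> (\<forall>j<k. g j \<noteq> 0)"

definition algorithm_W_run ::
  "(real ^ 'n \<Rightarrow> real) \<Rightarrow> real \<Rightarrow> (real ^ 'n \<Rightarrow> real \<Rightarrow> real ^ 'n) \<Rightarrow>
   real \<Rightarrow> real \<Rightarrow> real \<Rightarrow> real \<Rightarrow> real \<Rightarrow> real ^ 'n \<Rightarrow> real \<Rightarrow>
   (nat \<Rightarrow> real ^ 'n) \<Rightarrow> (nat \<Rightarrow> real) \<Rightarrow> (nat \<Rightarrow> real) \<Rightarrow> (nat \<Rightarrow> real ^ 'n) \<Rightarrow>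
   (nat \<Rightarrow> real ^ 'n) \<Rightarrow> (nat \<Rightarrow> real ^ 'n) \<Rightarrow> (nat \<Rightarrow> real) \<Rightarrow> (nat \<Rightarrow> real) \<Rightarrow> bool" where
  "algorithm_W_run f lam pa \<delta> \<sigma> \<eta> \<tau> \<rho>\<^sub>0 x\<^sub>0 \<epsilon>\<^sub>0 x \<epsilon> \<alpha> g y d \<beta> \<theta> \<longleftrightarrow>
     x 0 = x\<^sub>0 \<and> \<epsilon> 0 = \<epsilon>\<^sub>0 \<and> g 0 = inexact_gradient lam pa x\<^sub>0 \<epsilon>\<^sub>0 \<and> d 0 = - g 0 \<and> \<theta> 0 = 1 \<and>
     (\<forall>k. performed g k \<longrightarrow>
        \<epsilon> (Suc k) \<in> {0<..<\<epsilon> k} \<and> \<alpha> k > 0 \<and>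
        x (Suc k) = x k + \<alpha> k *\<^sub>R d k \<and>
        g (Suc k) = inexact_gradient lam pa (x (Suc k)) (\<epsilon> (Suc k)) \<and>
        inexact_value f lam pa (x k + \<alpha> k *\<^sub>R d k) (\<epsilon> (Suc k)) - inexact_value f lam pa (x k) (\<epsilon> k)
          \<le> \<delta> * \<alpha> k * (g k \<bullet> d k) \<and>
        g (Suc k) \<bullet> d k \<ge> \<sigma> * (g k \<bullet> d k) \<and>
        y k = g (Suc k) - g k \<and>
        \<beta> k = beta_update \<rho>\<^sub>0 (g (Suc k)) (d k) (y k) \<and>
        \<theta> (Suc k) = theta_update \<eta> \<tau> \<rho>\<^sub>0 (g (Suc k)) (d k) (y k) \<and>
        d (Suc k) = - (\<theta> (Suc k) *\<^sub>R g (Suc k)) + \<beta> k *\<^sub>R d k)"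

end

theory Submission
  imports Defs
begin

text \<open>Each search direction is a multiple \<open>- \<theta> *\<^sub>R g\<close> of the steepest descent direction plus a
  momentum term \<open>\<beta> *\<^sub>R d\<close>, and the safeguard on \<open>\<beta>\<close> keeps the momentum term no longer than a
  quarter of \<open>norm g\<close>. By Cauchy--Schwarz such a perturbation changes the slope \<open>g \<bullet> (- \<theta> *\<^sub>R g)\<close> by
  at most \<open>(norm g)\<^sup>2 / 4\<close>, and by the triangle inequality it changes the length \<open>\<theta> * norm g\<close> by at
  most \<open>norm g / 4\<close>. The initial direction is the case of zero momentum. The bound on the
  momentum term (\<open>norm_beta_update_le\<close>) holds whatever the previous direction was, so each
  index can be treated on its own.\<close>

text \<open>When the fallback value of \<open>\<beta>\<close> is used, \<open>sgn\<close> has modulus at most one and the factor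
  \<open>norm d\<close> cancels against the denominator; if \<open>d = 0\<close>, the momentum term vanishes whatever
  value totalised division gives to \<open>\<beta>\<close>.\<close>

lemma norm_beta_update_le:
  "norm (beta_update \<rho> g d y *\<^sub>R d) \<le> norm g / 4"
proof (cases "d = 0")
  case False
  have "\<bar>sgn (beta_hat g d y)\<bar> * norm g / 4 \<le> norm g / 4"
    by (simp add: abs_sgn_eq)
  with False show ?thesis
    by (auto simp: beta_update_def abs_mult)
qed simp

text \<open>The sign of \<open>\<theta>\<close> matters only for the length of the direction, where \<open>\<bar>\<theta>\<bar>\<close> has to be
  replaced by \<open>\<theta>\<close>.\<close>

lemma theta_update_nonneg:
  assumes "\<eta> \<ge> 0"
  shows "theta_update \<eta> \<tau> \<rho> g d y \<ge> 0"
  using assms by (auto simp: theta_update_def)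

lemma perturbed_steepest_descent_bounds:
  fixes g v :: "'a::real_inner"
  assumes "norm v \<le> c * norm g" and "\<theta> \<ge> 0"
  shows "g \<bullet> (- (\<theta> *\<^sub>R g) + v) \<le> - (\<theta> - c) * (norm g)\<^sup>2"
    and "norm (- (\<theta> *\<^sub>R g) + v) \<le> (\<theta> + c) * norm g"
proof -
  have "g \<bullet> v \<le> norm g * norm v"
    by (rule norm_cauchy_schwarz)
  also have "\<dots> \<le> norm g * (c * norm g)"
    using assms(1) by (rule mult_left_mono) simp
  finally show "g \<bullet> (- (\<theta> *\<^sub>R g) + v) \<le> - (\<theta> - c) * (norm g)\<^sup>2"
    by (simp add: inner_add_right power2_norm_eq_inner[symmetric] power2_eq_square algebra_simps)
  show "norm (- (\<theta> *\<^sub>R g) + v) \<le> (\<theta> + c) * norm g"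
    using norm_triangle_ineq[of "- (\<theta> *\<^sub>R g)" v] assms by (simp add: algebra_simps)
qed

theorem lemma3p1:
  fixes f :: "real ^ 'n \<Rightarrow> real"
    and pa :: "real ^ 'n \<Rightarrow> real \<Rightarrow> real ^ 'n"
    and lam \<delta> \<sigma> \<eta> \<tau> \<rho>\<^sub>0 \<epsilon>\<^sub>0 :: real
    and x\<^sub>0 :: "real ^ 'n"
    and x g y d :: "nat \<Rightarrow> real ^ 'n"
    and \<epsilon> \<alpha> \<beta> \<theta> :: "nat \<Rightarrow> real"
  assumes "convex_on UNIV f"
    and "locally_lipschitz f"
    and "lam > 0"
    and "inexact_prox f lam pa"
    and "0 < \<delta>" and "\<delta> \<le> \<sigma>" and "\<sigma> < 1"
    and "0 < \<eta>" and "\<eta> < 3 / 4"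
    and "\<tau> > 1 / 4 + \<eta>"
    and "\<epsilon>\<^sub>0 \<in> {0<..<1}"
    and "\<rho>\<^sub>0 > 0"
    and "algorithm_W_run f lam pa \<delta> \<sigma> \<eta> \<tau> \<rho>\<^sub>0 x\<^sub>0 \<epsilon>\<^sub>0 x \<epsilon> \<alpha> g y d \<beta> \<theta>"
  shows "\<forall>k. generated g k \<longrightarrow>
           g k \<bullet> d k \<le> - (\<theta> k - 1 / 4) * (norm (g k))\<^sup>2 \<and>
           norm (d k) \<le> (\<theta> k + 1 / 4) * norm (g k)"
proof (intro allI impI)
  fix k
  assume gen: "generated g k"
  note run = assms(13)[unfolded algorithm_W_run_def]
  have "\<exists>v. d k = - (\<theta> k *\<^sub>R g k) + v \<and> norm v \<le> 1 / 4 * norm (g k) \<and> \<theta> k \<ge> 0"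
  proof (cases k)
    case 0
    then show ?thesis
      using run by (intro exI[of _ 0]) auto
  next
    case (Suc j)
    have "performed g j"
      using gen Suc by (auto simp: generated_def performed_def)
    then have "\<beta> j = beta_update \<rho>\<^sub>0 (g k) (d j) (y j)"
      and "\<theta> k = theta_update \<eta> \<tau> \<rho>\<^sub>0 (g k) (d j) (y j)"
      and "d k = - (\<theta> k *\<^sub>R g k) + \<beta> j *\<^sub>R d j"
      using run Suc by blast+
    then show ?thesis
      using norm_beta_update_le[of \<rho>\<^sub>0 "g k" "d j" "y j"] theta_update_nonneg[of \<eta>] \<open>0 < \<eta>\<close>
      by (intro exI[of _ "\<beta> j *\<^sub>R d j"]) simp
  qed
  then show "g k \<bullet> d k \<le> - (\<theta> k - 1 / 4) * (norm (g k))\<^sup>2 \<and>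
      norm (d k) \<le> (\<theta> k + 1 / 4) * norm (g k)"
    using perturbed_steepest_descent_bounds by metis
qed

end
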